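(* Let $v>0$ and let $(\gamma_m)_{m\ge1}$ be real angular relaxation rates with $\inf_{m\ge1}\gamma_m>0$. The density branch $\lambda(k)=\sum_{j\ge1}l_jk^{2j}$ of the uniform state, that is, the branch with $\lambda(0)=0$ of the continued fraction $$\lambda+2u_1=0,\qquad u_n=\frac{(vk/2)^2}{\lambda+\gamma_n+u_{n+1}}\quad(n\ge1),$$ has the property that, for every $j\ge1$, the coefficient $l_j$ depends only on $\gamma_1,\dots,\gamma_j$ (and $v$). Consequently, if two turning generators (with the same $v$, rates $(\gamma_m)$ and $(\gamma'_m)$, both bounded below by a positive constant) satisfy $\gamma_m=\gamma'_m$ for $1\le m\le M$, then their bulk density dispersions $\lambda(k)$ and $\lambda'(k)$ have identical coefficients through order $k^{2M}$, and the first order at which they can differ is $k^{2M+2}$.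
   Context: Run-and-tumble particles move at constant speed $v$ and reorient with an even turning kernel; the turning operator is diagonal on angular harmonics $f_m$ with eigenvalues $-\gamma_m$, $\gamma_0=0$. Linearising about the uniform isotropic state and Fourier transforming in space with wavenumber $k$ (even sector $f_{-m}=f_m$) gives $\lambda f_0=-ivkf_1$ and $(\lambda+\gamma_m)f_m=-\tfrac{ivk}{2}(f_{m-1}+f_{m+1})$ for $m\ge1$; with $u_m=\tfrac{ivk}{2}f_m/f_{m-1}$ this becomes the stated continued fraction. With $s=(vk/2)^2$, the solution $(u_m)$ meant is the one with $u_m=O(s)$ uniformly in $m$ for $(\lambda,s)$ near $(0,0)$ (equivalently the limit of the truncations $u_{N+1}=0$), and $\lambda$ is the analytic function of $s$ near $0$ with $\lambda=0$ at $s=0$ solving $\lambda+2u_1(\lambda,s)=0$; the series for $\lambda(k)$ is the resulting power series in $k^2$. *)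

theory Defs
  imports "HOL-Complex_Analysis.Complex_Analysis"
begin

text \<open>Only the values of a rate sequence at indices \<open>m \<ge> 1\<close> are meaningful;
  index 0 (the conserved density, rate 0) never enters.\<close>

definition positive_rates :: "(nat \<Rightarrow> real) \<Rightarrow> bool" where
  "positive_rates \<gamma> \<longleftrightarrow> (\<exists>c>0. \<forall>m\<ge>1. c \<le> \<gamma> m)"

text \<open>The recursion alone has many solutions; the one meant is selected by
  \<open>u\<^sub>n = O(s)\<close> uniformly in \<open>n\<close> for \<open>(\<lambda>, s)\<close> near \<open>(0, 0)\<close>. It is determined only
  near \<open>(0, 0)\<close> and for \<open>n \<ge> 1\<close>. The denominators are required to be nonzero because
  division by zero is total in HOL.\<close>

definition cf_solution ::
    "(nat \<Rightarrow> real) \<Rightarrow> (nat \<Rightarrow> complex \<Rightarrow> complex \<Rightarrow> complex) \<Rightarrow> bool" where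
  "cf_solution \<gamma> u \<longleftrightarrow>
     (\<exists>C::real. eventually (\<lambda>(lam, s). \<forall>n\<ge>1.
          lam + of_real (\<gamma> n) + u (Suc n) lam s \<noteq> 0 \<and>
          u n lam s = s / (lam + of_real (\<gamma> n) + u (Suc n) lam s) \<and>
          norm (u n lam s) \<le> C * norm s) (nhds (0, 0)))"

text \<open>The branch as an analytic germ at 0 in the variable \<open>s = (v k / 2)\<^sup>2\<close>.\<close>

definition density_branch_s :: "(nat \<Rightarrow> real) \<Rightarrow> (complex \<Rightarrow> complex) \<Rightarrow> bool" where
  "density_branch_s \<gamma> \<Lambda> \<longleftrightarrow>
     \<Lambda> analytic_on {0} \<and> \<Lambda> 0 = 0 \<and>
     (\<exists>u. cf_solution \<gamma> u \<and> (\<forall>\<^sub>F s in nhds 0. \<Lambda> s + 2 * u 1 (\<Lambda> s) s = 0))"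

definition density_branch :: "real \<Rightarrow> (nat \<Rightarrow> real) \<Rightarrow> (complex \<Rightarrow> complex) \<Rightarrow> bool" where
  "density_branch v \<gamma> lam \<longleftrightarrow>
     (\<exists>\<Lambda>. density_branch_s \<gamma> \<Lambda> \<and> lam = (\<lambda>k. \<Lambda> ((of_real v * k / 2)\<^sup>2)))"

definition is_dispersion_series :: "real \<Rightarrow> (nat \<Rightarrow> real) \<Rightarrow> complex fps \<Rightarrow> bool" where
  "is_dispersion_series v \<gamma> L \<longleftrightarrow> (\<exists>lam. density_branch v \<gamma> lam \<and> lam has_fps_expansion L)"

text \<open>The Taylor series of \<open>\<lambda>(k)\<close> in the variable \<open>k\<close> (not \<open>k\<^sup>2\<close>), so that the
  coefficient \<open>l\<^sub>j\<close> of \<open>k\<^bsup>2j\<^esup>\<close> sits at index \<open>2 * j\<close>.\<close>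

definition dispersion_series :: "real \<Rightarrow> (nat \<Rightarrow> real) \<Rightarrow> complex fps" where
  "dispersion_series v \<gamma> = (THE L. is_dispersion_series v \<gamma> L)"

definition dispersion_coeff :: "real \<Rightarrow> (nat \<Rightarrow> real) \<Rightarrow> nat \<Rightarrow> complex" where
  "dispersion_coeff v \<gamma> j = fps_nth (dispersion_series v \<gamma>) (2 * j)"

end

theory Submission
  imports Defs
begin

text \<open>Along the branch, \<open>w\<^sub>n(s) = u\<^sub>n(\<Lambda>(s), s)\<close> and \<open>\<Lambda>(s) = - 2 w\<^sub>1(s)\<close>, so the continued
  fraction and the dispersion relation merge into one system without \<open>\<lambda>\<close>:
  \<open>w\<^sub>n = s / (\<gamma>\<^sub>n - 2 w\<^sub>1 + w\<^sub>n\<^sub>+\<^sub>1)\<close> for \<open>n \<ge> 1\<close>. For small \<open>s\<close> its right-hand side is a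
  contraction on small bounded sequences, because the rates are bounded below. Hence the small
  solution is unique (\<open>cf_fixed_unique\<close>) and, as a uniform limit of rational functions,
  holomorphic in \<open>s\<close> (\<open>cf_limit_holomorphic\<close>). Solving the merged system in \<open>s\<close> takes the place of
  the implicit function theorem for \<open>\<lambda> + 2 u\<^sub>1(\<lambda>, s) = 0\<close>.

  The Taylor series \<open>W\<^sub>n\<close> of \<open>w\<^sub>n\<close> satisfies \<open>W\<^sub>n (\<gamma>\<^sub>n - 2 W\<^sub>1 + W\<^sub>n\<^sub>+\<^sub>1) = X\<close>. For two rate
  sequences that agree up to \<open>M\<close>, each step down the fraction multiplies the difference of the
  series by \<open>X\<close> and a unit, and the first discrepancy enters at level \<open>M + 1\<close> with order 1. So
  \<open>W\<^sub>1 - W'\<^sub>1\<close> has order at least \<open>M + 1\<close> (\<open>formal_cf_agree\<close>), and exactly \<open>M + 1\<close> if the next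
  rates differ (\<open>formal_cf_differ\<close>). Since \<open>s = (v k / 2)\<^sup>2\<close>, order \<open>M + 1\<close> in \<open>s\<close> is order
  \<open>2 M + 2\<close> in \<open>k\<close>.\<close>

section \<open>The contraction behind the continued fraction\<close>

text \<open>The parameters \<open>a\<close> and \<open>t\<close> cover two uses: \<open>t = 0\<close> is the given recursion at fixed
  \<open>\<lambda> = a\<close>, while \<open>a = 0\<close>, \<open>t = -2\<close> inserts the dispersion relation \<open>\<lambda> = - 2 u\<^sub>1\<close> into it. For
  \<open>t = 0\<close> the iterates started from 0 are the truncations of the continued fraction.\<close>

fun cf_iter ::
    "(nat \<Rightarrow> complex) \<Rightarrow> complex \<Rightarrow> complex \<Rightarrow> complex \<Rightarrow> nat \<Rightarrow> nat \<Rightarrow> complex" where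
  "cf_iter g a t s 0 n = 0"
| "cf_iter g a t s (Suc k) n =
     s / (a + t * cf_iter g a t s k 1 + g n + cf_iter g a t s k (Suc n))"

definition cf_fixed ::
    "(nat \<Rightarrow> complex) \<Rightarrow> complex \<Rightarrow> complex \<Rightarrow> complex \<Rightarrow> (nat \<Rightarrow> complex) \<Rightarrow> bool" where
  "cf_fixed g a t s w \<longleftrightarrow> (\<forall>n\<ge>1. w n = s / (a + t * w 1 + g n + w (Suc n)))"

lemma cf_denominator_ge:
  fixes a t x y h :: complex
  assumes "c \<le> norm h" "norm a \<le> c / 4" "norm t \<le> 2" "norm x \<le> c / 12" "norm y \<le> c / 12"
  shows "c / 2 \<le> norm (a + t * x + h + y)"
proof -
  have "norm (t * x) \<le> 2 * (c / 12)"
    unfolding norm_mult using assms by (intro mult_mono) auto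
  moreover have "norm h \<le> norm (a + t * x + h + y) + norm a + norm (t * x) + norm y"
    using norm_triangle_ineq4[of "a + t * x + h + y" "a + t * x + y"]
      norm_triangle_ineq[of "a + t * x" y] norm_triangle_ineq[of a "t * x"] by simp
  ultimately show ?thesis using assms by linarith
qed

lemma cf_step_bound:
  fixes a t x y h s :: complex
  assumes "c > 0" "c \<le> norm h" "norm a \<le> c / 4" "norm t \<le> 2" "norm x \<le> c / 12" "norm y \<le> c / 12"
  shows "norm (s / (a + t * x + h + y)) \<le> 2 / c * norm s"
proof -
  have "c / 2 \<le> norm (a + t * x + h + y)" using assms by (intro cf_denominator_ge) auto
  then have "norm s / norm (a + t * x + h + y) \<le> norm s / (c / 2)"
    using assms(1) by (intro divide_left_mono mult_pos_pos) auto
  then show ?thesis by (simp add: norm_divide field_simps)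
qed

lemma cf_small_bound:
  assumes "c > 0" "norm (s::complex) \<le> c\<^sup>2 / 24"
  shows "2 / c * norm s \<le> c / 12"
  using assms by (simp add: field_simps power2_eq_square)

text \<open>Two quotients with denominators of modulus at least \<open>c / 2\<close> differ by
  \<open>s (denominator difference) / (denominator product)\<close>; a difference of at most \<open>D\<close> in each
  entry moves the denominator by at most \<open>3 D\<close>, so \<open>\<bar>s\<bar> \<le> c\<^sup>2 / 24\<close> gives the factor 1/2.\<close>

lemma cf_step_contraction:
  fixes a t x y x' y' h s :: complex
  assumes c: "c > 0" "c \<le> norm h" "norm a \<le> c / 4" "norm t \<le> 2"
    and b: "norm x \<le> c / 12" "norm y \<le> c / 12" "norm x' \<le> c / 12" "norm y' \<le> c / 12"
    and s: "norm s \<le> c\<^sup>2 / 24"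
    and D: "norm (x - x') \<le> D" "norm (y - y') \<le> D"
  shows "norm (s / (a + t * x + h + y) - s / (a + t * x' + h + y')) \<le> D / 2"
proof -
  define P where "P = a + t * x + h + y"
  define Q where "Q = a + t * x' + h + y'"
  have P: "c / 2 \<le> norm P" and Q: "c / 2 \<le> norm Q"
    unfolding P_def Q_def
    by (rule cf_denominator_ge[OF c(2-4) b(1,2)], rule cf_denominator_ge[OF c(2-4) b(3,4)])
  have nz: "P \<noteq> 0" "Q \<noteq> 0" using P Q c by auto
  have D0: "0 \<le> D" using D(1) norm_ge_zero order_trans by blast
  have eq: "Q - P = - (t * (x - x') + (y - y'))" by (simp add: P_def Q_def algebra_simps)
  have "norm (t * (x - x') + (y - y')) \<le> norm t * norm (x - x') + norm (y - y')"
    by (metis norm_mult norm_triangle_ineq)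
  also have "\<dots> \<le> 2 * D + D" using c D by (intro add_mono mult_mono) auto
  finally have diff: "norm (Q - P) \<le> 3 * D" unfolding eq norm_minus_cancel by simp
  have PQ: "(c / 2) * (c / 2) \<le> norm P * norm Q"
    using P Q c by (intro mult_mono) auto
  have num: "norm s * norm (Q - P) \<le> (c\<^sup>2 / 24) * (3 * D)"
    using s diff by (intro mult_mono) auto
  have "norm (s / P - s / Q) = norm s * norm (Q - P) / (norm P * norm Q)"
    using nz by (simp add: diff_frac_eq norm_divide norm_mult flip: right_diff_distrib)
  also have "\<dots> \<le> (c\<^sup>2 / 24) * (3 * D) / ((c / 2) * (c / 2))"
    using num PQ c D0 by (intro frac_le) auto
  also have "\<dots> = D / 2" using c by (simp add: field_simps power2_eq_square)
  finally show ?thesis unfolding P_def Q_def .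
qed

lemma cf_fixed_unique:
  assumes c: "c > 0" "\<forall>n\<ge>1. c \<le> norm (g n)" "norm a \<le> c / 4" "norm t \<le> 2"
    and s: "norm s \<le> c\<^sup>2 / 24"
    and w: "cf_fixed g a t s w" "\<forall>n\<ge>1. norm (w n) \<le> c / 12"
    and w': "cf_fixed g a t s w'" "\<forall>n\<ge>1. norm (w' n) \<le> c / 12"
    and n: "n \<ge> 1"
  shows "w n = w' n"
proof -
  have "norm (w n - w' n) \<le> (c / 6) * (1/2) ^ k" if "n \<ge> 1" for k n
    using that
  proof (induction k arbitrary: n)
    case 0
    then have "norm (w n) \<le> c / 12" "norm (w' n) \<le> c / 12" using w(2) w'(2) by auto
    then show ?case using norm_triangle_ineq4[of "w n" "w' n"] by simp
  next
    case (Suc k)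
    have eqs: "w n = s / (a + t * w 1 + g n + w (Suc n))"
        "w' n = s / (a + t * w' 1 + g n + w' (Suc n))"
      using w(1) w'(1) Suc.prems unfolding cf_fixed_def by blast+
    have "norm (s / (a + t * w 1 + g n + w (Suc n)) - s / (a + t * w' 1 + g n + w' (Suc n)))
        \<le> ((c / 6) * (1/2) ^ k) / 2"
      using c s w w' Suc by (intro cf_step_contraction[where c = c]) auto
    then show ?case unfolding eqs[symmetric] by simp
  qed
  then have "norm (w n - w' n) \<le> (c / 6) * (1/2) ^ k" for k using n by blast
  moreover have "(\<lambda>k. (c / 6) * (1/2) ^ k) \<longlonglongrightarrow> 0"
    by (intro tendsto_mult_right_zero LIMSEQ_power_zero) simp
  ultimately have "norm (w n - w' n) \<le> 0"
    by (meson LIMSEQ_le_const)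
  then show ?thesis by simp
qed

lemma cf_iter_bound:
  assumes c: "c > 0" "\<forall>n\<ge>1. c \<le> norm (g n)" "norm a \<le> c / 4" "norm t \<le> 2"
    and s: "norm s \<le> c\<^sup>2 / 24"
    and n: "n \<ge> 1"
  shows "norm (cf_iter g a t s k n) \<le> 2 / c * norm s" "norm (cf_iter g a t s k n) \<le> c / 12"
proof -
  have "norm (cf_iter g a t s k n) \<le> 2 / c * norm s \<and> norm (cf_iter g a t s k n) \<le> c / 12"
    using n
  proof (induction k arbitrary: n)
    case 0
    then show ?case using c by simp
  next
    case (Suc k)
    have "norm (cf_iter g a t s (Suc k) n) \<le> 2 / c * norm s"
      unfolding cf_iter.simps using c Suc by (intro cf_step_bound) auto
    then show ?case using cf_small_bound[OF c(1) s] by linarith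
  qed
  then show "norm (cf_iter g a t s k n) \<le> 2 / c * norm s" "norm (cf_iter g a t s k n) \<le> c / 12"
    by auto
qed

text \<open>The starting value 0 makes the first difference a single iterate, bounded by \<open>c / 12\<close>
  uniformly in \<open>m\<close> and \<open>n\<close>; so the iterates are uniformly Cauchy without summing a
  geometric series.\<close>

lemma cf_iter_cauchy:
  assumes c: "c > 0" "\<forall>n\<ge>1. c \<le> norm (g n)" "norm a \<le> c / 4" "norm t \<le> 2"
    and s: "norm s \<le> c\<^sup>2 / 24"
    and n: "n \<ge> 1"
  shows "norm (cf_iter g a t s (k + m) n - cf_iter g a t s k n) \<le> (c / 12) * (1/2) ^ k"
  using n
proof (induction k arbitrary: n)
  case 0
  then show ?case using cf_iter_bound[OF c s] by simp
next
  case (Suc k)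
  have "norm (cf_iter g a t s (Suc (k + m)) n - cf_iter g a t s (Suc k) n)
      \<le> ((c / 12) * (1/2) ^ k) / 2"
    unfolding cf_iter.simps
    using c s Suc cf_iter_bound(2)[OF c s] by (intro cf_step_contraction[where c = c]) auto
  then show ?case by simp
qed

definition cf_limit ::
    "(nat \<Rightarrow> complex) \<Rightarrow> complex \<Rightarrow> complex \<Rightarrow> complex \<Rightarrow> nat \<Rightarrow> complex" where
  "cf_limit g a t s n = lim (\<lambda>k. cf_iter g a t s k n)"

lemma cf_limit:
  assumes c: "c > 0" "\<forall>n\<ge>1. c \<le> norm (g n)" "norm a \<le> c / 4" "norm t \<le> 2"
    and s: "norm s \<le> c\<^sup>2 / 24"
  shows cf_iter_rate:
      "n \<ge> 1 \<Longrightarrow> norm (cf_limit g a t s n - cf_iter g a t s k n) \<le> (c / 12) * (1/2) ^ k"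
    and cf_limit_bound: "n \<ge> 1 \<Longrightarrow> norm (cf_limit g a t s n) \<le> 2 / c * norm s"
    and cf_limit_fixed: "cf_fixed g a t s (cf_limit g a t s)"
proof -
  have zero: "(\<lambda>k. (c / 12) * (1/2) ^ k) \<longlonglongrightarrow> 0"
    by (intro tendsto_mult_right_zero LIMSEQ_power_zero) simp
  have conv: "(\<lambda>k. cf_iter g a t s k n) \<longlonglongrightarrow> cf_limit g a t s n" if n: "n \<ge> 1" for n
  proof -
    have "Cauchy (\<lambda>k. cf_iter g a t s k n)"
    proof (rule metric_CauchyI)
      fix e :: real
      assume "e > 0"
      then have "\<forall>\<^sub>F k in sequentially. (c / 12) * (1/2) ^ k < e / 2"
        by (intro order_tendstoD(2)[OF zero]) auto
      then obtain k where k: "(c / 12) * (1/2) ^ k < e / 2"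
        by (auto simp: eventually_sequentially)
      have near: "dist (cf_iter g a t s p n) (cf_iter g a t s k n) < e / 2" if "p \<ge> k" for p
        using cf_iter_cauchy[OF c s n, where k = k and m = "p - k"] k that by (simp add: dist_norm)
      show "\<exists>N. \<forall>p\<ge>N. \<forall>q\<ge>N. dist (cf_iter g a t s p n) (cf_iter g a t s q n) < e"
        using dist_triangle_half_l[OF near near] by auto
    qed
    then show ?thesis
      unfolding cf_limit_def by (simp add: Cauchy_convergent_iff convergent_LIMSEQ_iff)
  qed
  show "norm (cf_limit g a t s n - cf_iter g a t s k n) \<le> (c / 12) * (1/2) ^ k" if n: "n \<ge> 1"
  proof (rule LIMSEQ_le_const2)
    show "(\<lambda>m. norm (cf_iter g a t s (m + k) n - cf_iter g a t s k n))
        \<longlonglongrightarrow> norm (cf_limit g a t s n - cf_iter g a t s k n)"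
      by (intro tendsto_intros LIMSEQ_ignore_initial_segment conv n)
    show "\<exists>N. \<forall>m\<ge>N. norm (cf_iter g a t s (m + k) n - cf_iter g a t s k n) \<le> (c / 12) * (1/2) ^ k"
      using cf_iter_cauchy[OF c s n, where k = k] by (auto simp: add.commute)
  qed
  have bound: "norm (cf_limit g a t s n) \<le> 2 / c * norm s" if n: "n \<ge> 1" for n
    by (rule LIMSEQ_le_const2[OF tendsto_norm[OF conv[OF n]]]) (use cf_iter_bound[OF c s n] in auto)
  then show "n \<ge> 1 \<Longrightarrow> norm (cf_limit g a t s n) \<le> 2 / c * norm s" .
  show "cf_fixed g a t s (cf_limit g a t s)"
    unfolding cf_fixed_def
  proof (intro allI impI)
    fix n :: nat
    assume n: "n \<ge> 1"
    have small: "norm (cf_limit g a t s m) \<le> c / 12" if "m \<ge> 1" for m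
      using bound[OF that] cf_small_bound[OF c(1) s] by linarith
    have "c / 2 \<le> norm (a + t * cf_limit g a t s 1 + g n + cf_limit g a t s (Suc n))"
      using c n small by (intro cf_denominator_ge) auto
    then have nz: "a + t * cf_limit g a t s 1 + g n + cf_limit g a t s (Suc n) \<noteq> 0"
      using c by auto
    have "(\<lambda>k. cf_iter g a t s (Suc k) n)
        \<longlonglongrightarrow> s / (a + t * cf_limit g a t s 1 + g n + cf_limit g a t s (Suc n))"
      unfolding cf_iter.simps by (intro tendsto_intros conv nz) auto
    moreover have "(\<lambda>k. cf_iter g a t s (Suc k) n) \<longlonglongrightarrow> cf_limit g a t s n"
      by (rule LIMSEQ_Suc[OF conv[OF n]])
    ultimately show "cf_limit g a t s n
        = s / (a + t * cf_limit g a t s 1 + g n + cf_limit g a t s (Suc n))"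
      using LIMSEQ_unique by blast
  qed
qed

lemma cf_limit_holomorphic:
  assumes c: "c > 0" "\<forall>n\<ge>1. c \<le> norm (g n)" "norm a \<le> c / 4" "norm t \<le> 2"
    and n: "n \<ge> 1"
  shows "(\<lambda>s. cf_limit g a t s n) holomorphic_on ball 0 (c\<^sup>2 / 24)"
proof (rule holomorphic_uniform_sequence)
  let ?B = "ball (0::complex) (c\<^sup>2 / 24)"
  show "open ?B" by simp
  show "(\<lambda>s. cf_iter g a t s k n) holomorphic_on ?B" for k
    using n
  proof (induction k arbitrary: n)
    case 0
    then show ?case by simp
  next
    case (Suc k)
    have "a + t * cf_iter g a t s k 1 + g n + cf_iter g a t s k (Suc n) \<noteq> 0" if "s \<in> ?B" for s
    proof -
      have s: "norm s \<le> c\<^sup>2 / 24" using that by simp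
      have "c / 2 \<le> norm (a + t * cf_iter g a t s k 1 + g n + cf_iter g a t s k (Suc n))"
        using c Suc.prems cf_iter_bound(2)[OF c s] by (intro cf_denominator_ge) auto
      then show ?thesis using c by auto
    qed
    then show ?case
      unfolding cf_iter.simps using Suc by (intro holomorphic_intros) auto
  qed
  fix x :: complex
  assume "x \<in> ?B"
  then obtain d where d: "d > 0" "cball x d \<subseteq> ?B"
    by (meson open_ball open_contains_cball)
  have "uniform_limit (cball x d) (\<lambda>k s. cf_iter g a t s k n) (\<lambda>s. cf_limit g a t s n) sequentially"
  proof (rule uniform_limitI)
    fix e :: real
    assume "e > 0"
    have "(\<lambda>k. (c / 12) * (1/2) ^ k) \<longlonglongrightarrow> 0"
      by (intro tendsto_mult_right_zero LIMSEQ_power_zero) simp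
    then have "\<forall>\<^sub>F k in sequentially. (c / 12) * (1/2) ^ k < e"
      using \<open>e > 0\<close> by (intro order_tendstoD(2)) auto
    then show "\<forall>\<^sub>F k in sequentially. \<forall>s\<in>cball x d.
        dist (cf_iter g a t s k n) (cf_limit g a t s n) < e"
    proof eventually_elim
      case (elim k)
      show ?case
      proof
        fix s assume "s \<in> cball x d"
        then have "norm s \<le> c\<^sup>2 / 24" using d by force
        from cf_iter_rate[OF c this n, of k] elim
        show "dist (cf_iter g a t s k n) (cf_limit g a t s n) < e"
          by (simp add: dist_norm norm_minus_commute)
      qed
    qed
  qed
  then show "\<exists>d>0. cball x d \<subseteq> ?B \<and>
      uniform_limit (cball x d) (\<lambda>k s. cf_iter g a t s k n) (\<lambda>s. cf_limit g a t s n) sequentially"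
    using d by blast
qed

section \<open>Formal continued fractions\<close>

definition formal_cf :: "'a \<Rightarrow> (nat \<Rightarrow> 'a::field) \<Rightarrow> (nat \<Rightarrow> 'a fps) \<Rightarrow> bool" where
  "formal_cf t g W \<longleftrightarrow> (\<forall>n\<ge>1. fps_nth (W n) 0 = 0 \<and>
     W n * (fps_const t * W 1 + fps_const (g n) + W (Suc n)) = fps_X)"

lemma fps_quotient_leading:
  fixes d U S :: "'a::field fps"
  assumes "d * U = fps_X * S" "fps_nth U 0 \<noteq> 0" "\<And>i. i < k \<Longrightarrow> fps_nth S i = 0"
  shows "fps_nth d (Suc k) = fps_nth S k / fps_nth U 0"
proof -
  have "d = fps_X * (S * inverse U)"
    using assms(1,2) by (metis inverse_mult_eq_1' mult.assoc mult.right_neutral)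
  then have "fps_nth d (Suc k) = fps_nth (S * inverse U) k"
    by simp
  also have "\<dots> = (\<Sum>i=0..k. fps_nth S i * fps_nth (inverse U) (k - i))"
    by (rule fps_mult_nth)
  also have "\<dots> = (\<Sum>i\<in>{k}. fps_nth S i * fps_nth (inverse U) (k - i))"
    by (rule sum.mono_neutral_right) (use assms(3) in auto)
  finally show ?thesis by (simp add: field_simps)
qed

text \<open>Both locality and its sharpness come from here: subtracting \<open>W\<^sub>n D\<^sub>n = X\<close> from
  \<open>W'\<^sub>n D'\<^sub>n = X\<close> shows that \<open>W\<^sub>n - W'\<^sub>n\<close> is \<open>X\<close> times a unit times the difference of the
  denominators, so the lowest term moves up by one order in each step down the fraction.\<close>

lemma formal_cf_diff_leading:
  fixes g g' :: "nat \<Rightarrow> 'a::field"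
  assumes W: "formal_cf t g W" "formal_cf t g' W'" and n: "n \<ge> 1" "g n \<noteq> 0" "g' n \<noteq> 0"
    and S: "S = fps_const (g' n - g n) - fps_const t * (W 1 - W' 1) - (W (Suc n) - W' (Suc n))"
    and k: "\<And>i. i < k \<Longrightarrow> fps_nth S i = 0"
  shows "fps_nth (W n - W' n) (Suc k) = fps_nth S k / (g n * g' n)"
proof -
  define D where "D = fps_const t * W 1 + fps_const (g n) + W (Suc n)"
  define D' where "D' = fps_const t * W' 1 + fps_const (g' n) + W' (Suc n)"
  have X: "W n * D = fps_X" "W' n * D' = fps_X"
    using W n unfolding formal_cf_def D_def D'_def by auto
  have "(W n - W' n) * (D * D') = (W n * D) * D' - (W' n * D') * D" by (simp add: algebra_simps)
  also have "\<dots> = fps_X * (D' - D)" unfolding X by (simp add: algebra_simps)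
  also have "D' - D = S"
    unfolding S D_def D'_def fps_const_sub[symmetric] by (simp add: algebra_simps del: fps_const_sub)
  finally have eq: "(W n - W' n) * (D * D') = fps_X * S" .
  have D0: "fps_nth (D * D') 0 = g n * g' n"
    using W n unfolding formal_cf_def D_def D'_def by simp
  show ?thesis
    using fps_quotient_leading[OF eq _ k] D0 n by (metis no_zero_divisors)
qed

lemma formal_cf_agree:
  fixes g g' :: "nat \<Rightarrow> 'a::field"
  assumes W: "formal_cf t g W" "formal_cf t g' W'"
    and nz: "\<And>n. n \<ge> 1 \<Longrightarrow> g n \<noteq> 0" "\<And>n. n \<ge> 1 \<Longrightarrow> g' n \<noteq> 0"
    and agree: "\<And>n. n \<in> {1..M} \<Longrightarrow> g n = g' n"
    and "n \<ge> 1" "n + j \<le> Suc M"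
  shows "fps_nth (W n - W' n) j = 0"
  using assms(6,7)
proof (induction j arbitrary: n rule: less_induct)
  case (less j)
  show ?case
  proof (cases j)
    case 0
    then show ?thesis using W less.prems unfolding formal_cf_def by simp
  next
    case (Suc k)
    define S where
      "S = fps_const (g' n - g n) - fps_const t * (W 1 - W' 1) - (W (Suc n) - W' (Suc n))"
    have "fps_nth S i = 0" if "i \<le> k" for i
      using less.IH[of i 1] less.IH[of i "Suc n"] less.prems that agree[of n] Suc
      unfolding S_def by simp
    then show ?thesis
      using formal_cf_diff_leading[OF W less.prems(1) _ _ S_def, of k] nz less.prems Suc by simp
  qed
qed

text \<open>The difference at level \<open>M + 1\<close> starts at order 1, and each step down adds one order;
  the feedback term \<open>W\<^sub>1 - W'\<^sub>1\<close> has order at least \<open>M + 1\<close>, too high to cancel the lowest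
  term at any level \<open>n \<ge> 1\<close>.\<close>

lemma formal_cf_differ:
  fixes g g' :: "nat \<Rightarrow> 'a::field"
  assumes W: "formal_cf t g W" "formal_cf t g' W'"
    and nz: "\<And>n. n \<ge> 1 \<Longrightarrow> g n \<noteq> 0" "\<And>n. n \<ge> 1 \<Longrightarrow> g' n \<noteq> 0"
    and agree: "\<And>n. n \<in> {1..M} \<Longrightarrow> g n = g' n"
    and ne: "g (Suc M) \<noteq> g' (Suc M)"
    and "n \<ge> 1" "n + k = Suc M"
  shows "fps_nth (W n - W' n) (Suc k) \<noteq> 0"
  using assms(7,8)
proof (induction k arbitrary: n)
  case 0
  then have n: "n = Suc M" by simp
  show ?case
    using formal_cf_diff_leading[OF W 0(1) _ _ refl, of 0] nz[OF 0(1)] W ne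
    unfolding formal_cf_def n by simp
next
  case (Suc k)
  define S where
    "S = fps_const (g' n - g n) - fps_const t * (W 1 - W' 1) - (W (Suc n) - W' (Suc n))"
  have low: "fps_nth (W 1 - W' 1) i = 0" if "i \<le> Suc k" for i
    using Suc.prems that by (intro formal_cf_agree[OF W nz agree]) auto
  have "fps_nth (W (Suc n) - W' (Suc n)) i = 0" if "i < Suc k" for i
    using Suc.prems that by (intro formal_cf_agree[OF W nz agree]) auto
  then have zero: "fps_nth S i = 0" if "i < Suc k" for i
    using low[of i] that Suc.prems agree[of n] unfolding S_def by simp
  have "fps_nth S (Suc k) \<noteq> 0"
    using Suc.IH[of "Suc n"] low[of "Suc k"] Suc.prems agree[of n] unfolding S_def by simp
  then show ?case
    using formal_cf_diff_leading[OF W Suc.prems(1) _ _ S_def zero] nz Suc.prems by simp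
qed

section \<open>The density branch\<close>

text \<open>Any admissible \<open>u\<close>, evaluated on the curve \<open>\<lambda> = \<Lambda>(s)\<close>, is a small fixed point of the
  iteration with \<open>a = 0\<close>, \<open>t = -2\<close>; there is only one, which determines \<open>\<Lambda>\<close> near 0.
  Continuity of \<open>\<Lambda>\<close> at 0 keeps the curve inside the neighbourhood on which \<open>u\<close> is controlled.\<close>

lemma density_branch_s_unique:
  assumes c: "c > 0" "\<forall>n\<ge>1. c \<le> norm (of_real (\<gamma> n) :: complex)"
    and \<Lambda>: "density_branch_s \<gamma> \<Lambda>"
  shows "\<forall>\<^sub>F s in nhds 0. \<Lambda> s = - 2 * cf_limit (\<lambda>n. of_real (\<gamma> n)) 0 (-2) s 1"
proof -
  let ?g = "\<lambda>n. complex_of_real (\<gamma> n)"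
  obtain u C where
    u: "\<forall>\<^sub>F (lam, s) in nhds (0, 0). \<forall>n\<ge>1.
          lam + of_real (\<gamma> n) + u (Suc n) lam s \<noteq> 0 \<and>
          u n lam s = s / (lam + of_real (\<gamma> n) + u (Suc n) lam s) \<and>
          norm (u n lam s) \<le> C * norm s"
    and disp: "\<forall>\<^sub>F s in nhds 0. \<Lambda> s + 2 * u 1 (\<Lambda> s) s = 0"
    using \<Lambda> unfolding density_branch_s_def cf_solution_def by blast
  have "isCont \<Lambda> 0"
    using \<Lambda> analytic_at_imp_isCont unfolding density_branch_s_def by blast
  then have "filterlim \<Lambda> (nhds (\<Lambda> 0)) (nhds 0)"
    by (simp only: isCont_def tendsto_at_iff_tendsto_nhds)
  then have "filterlim \<Lambda> (nhds 0) (nhds 0)"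
    using \<Lambda> unfolding density_branch_s_def by simp
  then have "filterlim (\<lambda>s. (\<Lambda> s, s)) (nhds (0, 0)) (nhds 0)"
    by (intro tendsto_Pair filterlim_ident)
  from eventually_compose_filterlim[OF u this]
  have on_branch: "\<forall>\<^sub>F s in nhds 0. \<forall>n\<ge>1.
      u n (\<Lambda> s) s = s / (\<Lambda> s + ?g n + u (Suc n) (\<Lambda> s) s) \<and> norm (u n (\<Lambda> s) s) \<le> C * norm s"
    unfolding case_prod_conv by (rule eventually_mono) blast
  have "\<forall>\<^sub>F s in nhds (0::complex). C * norm s < c / 12"
    using c by (intro order_tendstoD(2)[where y = 0] tendsto_mult_right_zero
        tendsto_norm_zero filterlim_ident) auto
  moreover have "\<forall>\<^sub>F s in nhds (0::complex). norm s < c\<^sup>2 / 24"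
    using c by (intro order_tendstoD(2)[where y = 0] tendsto_mult_right_zero
        tendsto_norm_zero filterlim_ident) auto
  ultimately show ?thesis
    using on_branch disp
  proof eventually_elim
    case (elim s)
    have s: "norm s \<le> c\<^sup>2 / 24" using elim(2) by simp
    have \<Lambda>s: "\<Lambda> s = - 2 * u 1 (\<Lambda> s) s" using elim(4) by (simp add: eq_neg_iff_add_eq_0)
    have par: "norm (0::complex) \<le> c / 4" "norm (-2::complex) \<le> 2" using c by auto
    have fixed: "cf_fixed ?g 0 (-2) s (\<lambda>n. u n (\<Lambda> s) s)"
      using elim(3) unfolding cf_fixed_def \<Lambda>s[symmetric] add_0 by blast
    have small: "\<forall>n\<ge>1. norm (u n (\<Lambda> s) s) \<le> c / 12"
      using elim(1,3) by (meson less_imp_le order_trans)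
    have small': "\<forall>n\<ge>1. norm (cf_limit ?g 0 (-2) s n) \<le> c / 12"
      using cf_limit_bound[OF c par s] cf_small_bound[OF c(1) s] by (meson order_trans)
    have "u 1 (\<Lambda> s) s = cf_limit ?g 0 (-2) s 1"
      using cf_fixed_unique[OF c par s fixed small cf_limit_fixed[OF c par s] small' order_refl] .
    then show ?case using \<Lambda>s by (simp only:)
  qed
qed

text \<open>The same uniqueness, now for \<open>t = 0\<close> at \<open>a = \<Lambda>(s)\<close>, identifies the solution of the
  recursion at \<open>\<lambda> = \<Lambda>(s)\<close> with the solution of the merged system.\<close>

lemma density_branch_s_exists:
  assumes c: "c > 0" "\<forall>n\<ge>1. c \<le> norm (of_real (\<gamma> n) :: complex)"
  shows "density_branch_s \<gamma> (\<lambda>s. - 2 * cf_limit (\<lambda>n. of_real (\<gamma> n)) 0 (-2) s 1)"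
proof -
  let ?g = "\<lambda>n. complex_of_real (\<gamma> n)"
  define \<Lambda> where "\<Lambda> = (\<lambda>s. - 2 * cf_limit ?g 0 (-2) s 1)"
  define u where "u = (\<lambda>n lam s. cf_limit ?g lam 0 s n)"
  have pos: "c\<^sup>2 / 24 > 0" using c by simp
  have par: "norm (0::complex) \<le> c / 4" "norm (-2::complex) \<le> 2" "norm (0::complex) \<le> 2"
    using c by auto
  have "\<Lambda> holomorphic_on ball 0 (c\<^sup>2 / 24)"
    unfolding \<Lambda>_def using cf_limit_holomorphic[OF c par(1,2)] by (intro holomorphic_intros) auto
  then have ana: "\<Lambda> analytic_on {0}"
    using pos by (metis analytic_at centre_in_ball open_ball)
  have zero: "\<Lambda> 0 = 0"
    using cf_limit_bound[OF c par(1,2), where s = 0 and n = 1] by (simp add: \<Lambda>_def)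
  have sol: "cf_solution \<gamma> u"
    unfolding cf_solution_def
  proof (intro exI)
    have "\<forall>\<^sub>F p in nhds (0::complex \<times> complex). norm (fst p) < c / 4"
      using c by (intro order_tendstoD(2)[where y = 0] tendsto_norm_zero
          tendsto_fst[where a = 0, simplified] filterlim_ident) auto
    moreover have "\<forall>\<^sub>F p in nhds (0::complex \<times> complex). norm (snd p) < c\<^sup>2 / 24"
      using c by (intro order_tendstoD(2)[where y = 0] tendsto_norm_zero
          tendsto_snd[where a = 0, simplified] filterlim_ident) auto
    ultimately show "\<forall>\<^sub>F (lam, s) in nhds (0, 0). \<forall>n\<ge>1.
          lam + of_real (\<gamma> n) + u (Suc n) lam s \<noteq> 0 \<and>
          u n lam s = s / (lam + of_real (\<gamma> n) + u (Suc n) lam s) \<and>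
          norm (u n lam s) \<le> 2 / c * norm s"
      unfolding zero_prod_def
    proof eventually_elim
      case (elim p)
      obtain lam s where p: "p = (lam, s)" by (cases p)
      have lam: "norm lam \<le> c / 4" and s: "norm s \<le> c\<^sup>2 / 24" using elim by (auto simp: p)
      have bound: "norm (u n lam s) \<le> 2 / c * norm s" if "n \<ge> 1" for n
        unfolding u_def using cf_limit_bound[OF c lam par(3) s that] .
      have "lam + ?g n + u (Suc n) lam s \<noteq> 0" if "n \<ge> 1" for n
      proof -
        have "norm (u (Suc n) lam s) \<le> c / 12"
          using bound[of "Suc n"] cf_small_bound[OF c(1) s] by simp
        then have "c / 2 \<le> norm (lam + 0 * 0 + ?g n + u (Suc n) lam s)"
          using c that lam by (intro cf_denominator_ge) auto
        then show ?thesis using c by auto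
      qed
      moreover have "\<forall>n\<ge>1. u n lam s = s / (lam + ?g n + u (Suc n) lam s)"
        using cf_limit_fixed[OF c lam par(3) s]
        unfolding cf_fixed_def u_def mult_zero_left add_0_right .
      ultimately show ?case using bound unfolding p case_prod_conv by blast
    qed
  qed
  have "\<forall>\<^sub>F s in nhds (0::complex). norm s < c\<^sup>2 / 24"
    using pos by (intro order_tendstoD(2)[where y = 0] tendsto_mult_right_zero
        tendsto_norm_zero filterlim_ident) auto
  then have disp: "\<forall>\<^sub>F s in nhds 0. \<Lambda> s + 2 * u 1 (\<Lambda> s) s = 0"
  proof eventually_elim
    case (elim s)
    have s: "norm s \<le> c\<^sup>2 / 24" using elim by simp
    have small: "\<forall>n\<ge>1. norm (cf_limit ?g 0 (-2) s n) \<le> c / 12"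
      using cf_limit_bound[OF c par(1,2) s] cf_small_bound[OF c(1) s] by (meson order_trans)
    have lam: "norm (\<Lambda> s) \<le> c / 4"
      using small c by (auto simp: \<Lambda>_def norm_mult dest: spec[where x = 1])
    have fixed: "cf_fixed ?g (\<Lambda> s) 0 s (cf_limit ?g 0 (-2) s)"
      using cf_limit_fixed[OF c par(1,2) s]
      unfolding cf_fixed_def \<Lambda>_def mult_zero_left add_0_right add_0 .
    have small': "\<forall>n\<ge>1. norm (cf_limit ?g (\<Lambda> s) 0 s n) \<le> c / 12"
      using cf_limit_bound[OF c lam par(3) s] cf_small_bound[OF c(1) s] by (meson order_trans)
    have "cf_limit ?g 0 (-2) s 1 = u 1 (\<Lambda> s) s"
      unfolding u_def
      using cf_fixed_unique[OF c lam par(3) s fixed small cf_limit_fixed[OF c lam par(3) s] small'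
          order_refl] .
    then show ?case by (simp add: \<Lambda>_def)
  qed
  show ?thesis
    using ana zero sol disp unfolding density_branch_s_def \<Lambda>_def by blast
qed

lemma density_branch_s_formal:
  assumes "positive_rates \<gamma>"
  obtains W \<Lambda> where "formal_cf (-2) (\<lambda>n. complex_of_real (\<gamma> n)) W" "density_branch_s \<gamma> \<Lambda>"
    "\<forall>\<Lambda>'. density_branch_s \<gamma> \<Lambda>' \<longrightarrow> \<Lambda>' has_fps_expansion - 2 * W 1"
proof -
  let ?g = "\<lambda>n. complex_of_real (\<gamma> n)"
  obtain c where c0: "c > 0" and ge: "\<And>n. n \<ge> 1 \<Longrightarrow> c \<le> \<gamma> n"
    using assms unfolding positive_rates_def by blast
  have "\<forall>n\<ge>1. c \<le> norm (?g n)"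
    unfolding norm_of_real using ge by (meson abs_ge_self order_trans)
  with c0 have c: "c > 0" "\<forall>n\<ge>1. c \<le> norm (?g n)" by blast+
  have pos: "c\<^sup>2 / 24 > 0" using c by simp
  have par: "norm (0::complex) \<le> c / 4" "norm (-2::complex) \<le> 2" using c by auto
  define w where "w = (\<lambda>n s. cf_limit ?g 0 (-2) s n)"
  define W where "W = (\<lambda>n. fps_expansion (w n) 0)"
  have exp: "w n has_fps_expansion W n" if "n \<ge> 1" for n
  proof -
    have "w n analytic_on {0}"
      using cf_limit_holomorphic[OF c par that] pos unfolding w_def
      by (metis analytic_at centre_in_ball open_ball)
    then show ?thesis unfolding W_def by (rule analytic_at_imp_has_fps_expansion_0)
  qed
  have "formal_cf (-2) ?g W"
    unfolding formal_cf_def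
  proof (intro allI impI conjI)
    fix n :: nat
    assume n: "n \<ge> 1"
    have "w n 0 = 0"
      using cf_limit_bound[OF c par, where s = 0 and n = n] n by (simp add: w_def)
    then show "fps_nth (W n) 0 = 0"
      using has_fps_expansion_imp_0_eq_fps_nth_0[OF exp[OF n]] by simp
    have "(\<lambda>s. w n s * (- 2 * w 1 s + ?g n + w (Suc n) s)) has_fps_expansion
        W n * (fps_const (-2) * W 1 + fps_const (?g n) + W (Suc n))"
      using n by (intro fps_expansion_intros exp) auto
    moreover have "(\<lambda>s. w n s * (- 2 * w 1 s + ?g n + w (Suc n) s)) has_fps_expansion fps_X"
    proof -
      have "\<forall>\<^sub>F s in nhds (0::complex). norm s < c\<^sup>2 / 24"
        using pos by (intro order_tendstoD(2)[where y = 0] tendsto_mult_right_zero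
        tendsto_norm_zero filterlim_ident) auto
      then have near: "\<forall>\<^sub>F s in nhds 0. w n s * (- 2 * w 1 s + ?g n + w (Suc n) s) = s"
      proof eventually_elim
        case (elim s)
        have s: "norm s \<le> c\<^sup>2 / 24" using elim by simp
        have small: "norm (w m s) \<le> c / 12" if "m \<ge> 1" for m
          using cf_limit_bound[OF c par s that] cf_small_bound[OF c(1) s] unfolding w_def by linarith
        have "c / 2 \<le> norm (0 + (-2) * w 1 s + ?g n + w (Suc n) s)"
          using c n par small by (intro cf_denominator_ge) auto
        then have nz: "- 2 * w 1 s + ?g n + w (Suc n) s \<noteq> 0" using c by auto
        have "w n s = s / (- 2 * w 1 s + ?g n + w (Suc n) s)"
          using cf_limit_fixed[OF c par s] n unfolding cf_fixed_def w_def add_0 by blast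
        then show ?case using nz by (simp add: nonzero_eq_divide_eq)
      qed
      then show ?thesis
        using has_fps_expansion_cong[OF near refl, of fps_X] has_fps_expansion_fps_X by simp
    qed
    ultimately show "W n * (fps_const (-2) * W 1 + fps_const (?g n) + W (Suc n)) = fps_X"
      by (rule fps_expansion_unique_complex)
  qed
  moreover have "density_branch_s \<gamma> (\<lambda>s. - 2 * w 1 s)"
    unfolding w_def by (rule density_branch_s_exists[OF c])
  moreover have "\<Lambda>' has_fps_expansion - 2 * W 1" if "density_branch_s \<gamma> \<Lambda>'" for \<Lambda>'
  proof -
    have "(\<lambda>s. - 2 * w 1 s) has_fps_expansion fps_const (-2) * W 1"
      by (intro fps_expansion_intros exp) auto
    also have "fps_const (-2) * W 1 = - 2 * W 1"
      by (metis fps_const_neg numeral_fps_const)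
    finally show ?thesis
      using has_fps_expansion_cong[OF density_branch_s_unique[OF c that] refl, of "- 2 * W 1"]
      unfolding w_def by simp
  qed
  ultimately show ?thesis using that by blast
qed

lemma has_fps_expansion_scaled_square:
  fixes f :: "complex \<Rightarrow> complex"
  assumes "f has_fps_expansion F"
  shows "(\<lambda>k. f (b * k\<^sup>2)) has_fps_expansion
    Abs_fps (\<lambda>i. if even i then b ^ (i div 2) * fps_nth F (i div 2) else 0)"
proof -
  have scale: "(f \<circ> (\<lambda>s. b * s)) has_fps_expansion (F oo (fps_const b * fps_X))"
    using assms by (intro fps_expansion_intros) auto
  have "((f \<circ> (\<lambda>s. b * s)) \<circ> (\<lambda>k. k ^ 2)) has_fps_expansion
      ((F oo (fps_const b * fps_X)) oo (fps_X ^ 2))"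
    by (intro has_fps_expansion_compose scale fps_expansion_intros) auto
  also have "(F oo (fps_const b * fps_X)) oo (fps_X ^ 2) =
      Abs_fps (\<lambda>i. if even i then b ^ (i div 2) * fps_nth F (i div 2) else 0)"
    by (simp add: fps_eq_iff fps_compose_linear fps_nth_compose_X_power)
  finally show ?thesis by (simp add: o_def)
qed

lemma dispersion_series_formal:
  assumes "positive_rates \<gamma>"
  obtains W where "formal_cf (-2) (\<lambda>n. complex_of_real (\<gamma> n)) W"
    "\<forall>v. \<exists>!L. is_dispersion_series v \<gamma> L"
    "\<forall>v i. fps_nth (dispersion_series v \<gamma>) i =
       (if even i then ((of_real v)\<^sup>2 / 4) ^ (i div 2) * (- 2 * fps_nth (W 1) (i div 2)) else 0)"
proof -
  obtain W \<Lambda> where W: "formal_cf (-2) (\<lambda>n. complex_of_real (\<gamma> n)) W"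
    and \<Lambda>: "density_branch_s \<gamma> \<Lambda>"
    and exp: "\<forall>\<Lambda>'. density_branch_s \<gamma> \<Lambda>' \<longrightarrow> \<Lambda>' has_fps_expansion - 2 * W 1"
    using density_branch_s_formal[OF assms] by blast
  define L :: "real \<Rightarrow> complex fps" where "L = (\<lambda>v. Abs_fps (\<lambda>i. if even i
    then ((of_real v)\<^sup>2 / 4) ^ (i div 2) * fps_nth (- 2 * W 1) (i div 2) else 0))"
  have expL: "(\<lambda>k. \<Lambda>' ((of_real v * k / 2)\<^sup>2)) has_fps_expansion L v"
    if "density_branch_s \<gamma> \<Lambda>'" for v \<Lambda>'
    using has_fps_expansion_scaled_square[OF exp[rule_format, OF that], of "(of_real v)\<^sup>2 / 4"]
    unfolding L_def by (simp add: power_mult_distrib power_divide)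
  have iff: "is_dispersion_series v \<gamma> K \<longleftrightarrow> K = L v" for v K
    unfolding is_dispersion_series_def density_branch_def
    using expL \<Lambda> fps_expansion_unique_complex by blast
  have double: "fps_nth (- 2 * W 1) k = - 2 * fps_nth (W 1) k" for k
    by (metis fps_const_neg numeral_fps_const fps_mult_left_const_nth)
  from iff have "dispersion_series v \<gamma> = L v" for v
    unfolding dispersion_series_def by blast
  then have "fps_nth (dispersion_series v \<gamma>) i =
       (if even i then ((of_real v)\<^sup>2 / 4) ^ (i div 2) * (- 2 * fps_nth (W 1) (i div 2)) else 0)"
    for v i
    unfolding L_def by (simp only: fps_nth_Abs_fps double)
  moreover have "\<exists>!L. is_dispersion_series v \<gamma> L" for v by (simp add: iff)
  ultimately show ?thesis using that W by blast
qed

lemma positive_rates_nonzero: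
  assumes "positive_rates \<gamma>" "n \<ge> 1"
  shows "complex_of_real (\<gamma> n) \<noteq> 0"
  using assms unfolding positive_rates_def by (metis of_real_eq_0_iff linorder_not_le)

lemma dispersion_series_agree:
  assumes \<gamma>: "positive_rates \<gamma>" "positive_rates \<gamma>'"
    and agree: "\<And>m. m \<in> {1..M} \<Longrightarrow> \<gamma> m = \<gamma>' m"
    and i: "i < 2 * M + 2"
  shows "fps_nth (dispersion_series v \<gamma>) i = fps_nth (dispersion_series v \<gamma>') i"
proof -
  obtain W where W: "formal_cf (-2) (\<lambda>n. complex_of_real (\<gamma> n)) W"
    and coeff: "\<forall>v i. fps_nth (dispersion_series v \<gamma>) i =
       (if even i then ((of_real v)\<^sup>2 / 4) ^ (i div 2) * (- 2 * fps_nth (W 1) (i div 2)) else 0)"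
    by (rule dispersion_series_formal[OF \<gamma>(1)], rule that)
  obtain W' where W': "formal_cf (-2) (\<lambda>n. complex_of_real (\<gamma>' n)) W'"
    and coeff': "\<forall>v i. fps_nth (dispersion_series v \<gamma>') i =
       (if even i then ((of_real v)\<^sup>2 / 4) ^ (i div 2) * (- 2 * fps_nth (W' 1) (i div 2)) else 0)"
    by (rule dispersion_series_formal[OF \<gamma>(2)], rule that)
  have "fps_nth (W 1 - W' 1) (i div 2) = 0"
    using i agree positive_rates_nonzero[OF \<gamma>(1)] positive_rates_nonzero[OF \<gamma>(2)]
    by (intro formal_cf_agree[OF W W', where M = M]) auto
  then show ?thesis by (simp add: coeff coeff')
qed

lemma dispersion_series_differ:
  assumes \<gamma>: "positive_rates \<gamma>" "positive_rates \<gamma>'"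
    and agree: "\<And>m. m \<in> {1..M} \<Longrightarrow> \<gamma> m = \<gamma>' m"
    and ne: "\<gamma> (Suc M) \<noteq> \<gamma>' (Suc M)" and v: "v \<noteq> 0"
  shows "fps_nth (dispersion_series v \<gamma>) (2 * M + 2) \<noteq> fps_nth (dispersion_series v \<gamma>') (2 * M + 2)"
proof -
  obtain W where W: "formal_cf (-2) (\<lambda>n. complex_of_real (\<gamma> n)) W"
    and coeff: "\<forall>v i. fps_nth (dispersion_series v \<gamma>) i =
       (if even i then ((of_real v)\<^sup>2 / 4) ^ (i div 2) * (- 2 * fps_nth (W 1) (i div 2)) else 0)"
    by (rule dispersion_series_formal[OF \<gamma>(1)], rule that)
  obtain W' where W': "formal_cf (-2) (\<lambda>n. complex_of_real (\<gamma>' n)) W'"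
    and coeff': "\<forall>v i. fps_nth (dispersion_series v \<gamma>') i =
       (if even i then ((of_real v)\<^sup>2 / 4) ^ (i div 2) * (- 2 * fps_nth (W' 1) (i div 2)) else 0)"
    by (rule dispersion_series_formal[OF \<gamma>(2)], rule that)
  have "fps_nth (W 1 - W' 1) (Suc M) \<noteq> 0"
    using agree ne positive_rates_nonzero[OF \<gamma>(1)] positive_rates_nonzero[OF \<gamma>(2)]
    by (intro formal_cf_differ[OF W W', where M = M]) auto
  then show ?thesis using v by (simp add: coeff coeff')
qed

theorem theoremS1:
  "(\<forall>v>0. \<forall>\<gamma>. positive_rates \<gamma> \<longrightarrow>
      (\<exists>!L. is_dispersion_series v \<gamma> L) \<and>
      (\<forall>i. i = 0 \<or> odd i \<longrightarrow> fps_nth (dispersion_series v \<gamma>) i = 0)) \<and>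
   (\<forall>j\<ge>1. \<exists>F :: real \<Rightarrow> real list \<Rightarrow> complex. \<forall>v>0. \<forall>\<gamma>. positive_rates \<gamma> \<longrightarrow>
      dispersion_coeff v \<gamma> j = F v (map \<gamma> [1..<Suc j])) \<and>
   (\<forall>v>0. \<forall>\<gamma> \<gamma>' M. positive_rates \<gamma> \<longrightarrow> positive_rates \<gamma>' \<longrightarrow> (\<forall>m\<in>{1..M}. \<gamma> m = \<gamma>' m) \<longrightarrow>
      (\<forall>i\<le>2 * M. fps_nth (dispersion_series v \<gamma>) i = fps_nth (dispersion_series v \<gamma>') i) \<and>
      (\<forall>i. fps_nth (dispersion_series v \<gamma>) i \<noteq> fps_nth (dispersion_series v \<gamma>') i \<longrightarrow>
         2 * M + 2 \<le> i)) \<and>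
   (\<forall>v>0. \<forall>\<gamma> M. positive_rates \<gamma> \<longrightarrow>
      (\<exists>\<gamma>'. positive_rates \<gamma>' \<and> (\<forall>m\<in>{1..M}. \<gamma> m = \<gamma>' m) \<and>
         fps_nth (dispersion_series v \<gamma>) (2 * M + 2) \<noteq>
         fps_nth (dispersion_series v \<gamma>') (2 * M + 2)))"
proof (intro conjI)
  show "\<forall>v>0. \<forall>\<gamma>. positive_rates \<gamma> \<longrightarrow>
      (\<exists>!L. is_dispersion_series v \<gamma> L) \<and>
      (\<forall>i. i = 0 \<or> odd i \<longrightarrow> fps_nth (dispersion_series v \<gamma>) i = 0)"
  proof (intro allI impI)
    fix v :: real and \<gamma> :: "nat \<Rightarrow> real"
    assume \<gamma>: "positive_rates \<gamma>"
    obtain W where "formal_cf (-2) (\<lambda>n. complex_of_real (\<gamma> n)) W"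
      "\<forall>v. \<exists>!L. is_dispersion_series v \<gamma> L"
      "\<forall>v i. fps_nth (dispersion_series v \<gamma>) i =
       (if even i then ((of_real v)\<^sup>2 / 4) ^ (i div 2) * (- 2 * fps_nth (W 1) (i div 2)) else 0)"
      by (rule dispersion_series_formal[OF \<gamma>], rule that)
    then show "(\<exists>!L. is_dispersion_series v \<gamma> L) \<and>
      (\<forall>i. i = 0 \<or> odd i \<longrightarrow> fps_nth (dispersion_series v \<gamma>) i = 0)"
      unfolding formal_cf_def by auto
  qed
  show "\<forall>j\<ge>1. \<exists>F :: real \<Rightarrow> real list \<Rightarrow> complex. \<forall>v>0. \<forall>\<gamma>. positive_rates \<gamma> \<longrightarrow>
      dispersion_coeff v \<gamma> j = F v (map \<gamma> [1..<Suc j])"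
  proof (intro allI impI)
    fix j :: nat
    assume "j \<ge> 1"
    \<comment> \<open>Continue a finite list of rates by 1, which keeps it bounded below.\<close>
    define ext :: "real list \<Rightarrow> nat \<Rightarrow> real" where
      "ext = (\<lambda>xs m. if m \<in> {1..length xs} then xs ! (m - 1) else 1)"
    have "dispersion_coeff v \<gamma> j = dispersion_coeff v (ext (map \<gamma> [1..<Suc j])) j"
      if \<gamma>: "positive_rates \<gamma>" for v \<gamma>
    proof -
      let ?e = "ext (map \<gamma> [1..<Suc j])"
      have e: "?e m = (if m \<in> {1..j} then \<gamma> m else 1)" for m
        unfolding ext_def by (auto simp del: upt_Suc)
      obtain c where c: "c > 0" "\<And>m. m \<ge> 1 \<Longrightarrow> c \<le> \<gamma> m"
        using \<gamma> unfolding positive_rates_def by blast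
      have "positive_rates ?e"
        unfolding positive_rates_def e using c by (intro exI[of _ "min c 1"]) (auto simp: min_le_iff_disj)
      then show ?thesis
        unfolding dispersion_coeff_def using \<gamma> e
        by (intro dispersion_series_agree[where M = j]) auto
    qed
    then show "\<exists>F. \<forall>v>0. \<forall>\<gamma>. positive_rates \<gamma> \<longrightarrow>
        dispersion_coeff v \<gamma> j = F v (map \<gamma> [1..<Suc j])"
      by (intro exI[of _ "\<lambda>v xs. dispersion_coeff v (ext xs) j"]) blast
  qed
  show "\<forall>v>0. \<forall>\<gamma> \<gamma>' M. positive_rates \<gamma> \<longrightarrow> positive_rates \<gamma>' \<longrightarrow> (\<forall>m\<in>{1..M}. \<gamma> m = \<gamma>' m) \<longrightarrow>
      (\<forall>i\<le>2 * M. fps_nth (dispersion_series v \<gamma>) i = fps_nth (dispersion_series v \<gamma>') i) \<and>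
      (\<forall>i. fps_nth (dispersion_series v \<gamma>) i \<noteq> fps_nth (dispersion_series v \<gamma>') i \<longrightarrow>
         2 * M + 2 \<le> i)"
  proof (intro allI impI)
    fix v :: real and \<gamma> \<gamma>' :: "nat \<Rightarrow> real" and M :: nat
    assume "positive_rates \<gamma>" "positive_rates \<gamma>'" "\<forall>m\<in>{1..M}. \<gamma> m = \<gamma>' m"
    then have "fps_nth (dispersion_series v \<gamma>) i = fps_nth (dispersion_series v \<gamma>') i"
      if "i < 2 * M + 2" for i
      using that by (intro dispersion_series_agree) auto
    then show "(\<forall>i\<le>2 * M. fps_nth (dispersion_series v \<gamma>) i = fps_nth (dispersion_series v \<gamma>') i) \<and>
      (\<forall>i. fps_nth (dispersion_series v \<gamma>) i \<noteq> fps_nth (dispersion_series v \<gamma>') i \<longrightarrow>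
         2 * M + 2 \<le> i)"
      by (metis add_lessD1 le_imp_less_Suc add_2_eq_Suc' less_SucI not_le)
  qed
  show "\<forall>v>0. \<forall>\<gamma> M. positive_rates \<gamma> \<longrightarrow>
      (\<exists>\<gamma>'. positive_rates \<gamma>' \<and> (\<forall>m\<in>{1..M}. \<gamma> m = \<gamma>' m) \<and>
         fps_nth (dispersion_series v \<gamma>) (2 * M + 2) \<noteq>
         fps_nth (dispersion_series v \<gamma>') (2 * M + 2))"
  proof (intro allI impI)
    fix v :: real and \<gamma> :: "nat \<Rightarrow> real" and M :: nat
    assume v: "v > 0" and \<gamma>: "positive_rates \<gamma>"
    define \<gamma>' where "\<gamma>' = \<gamma>(Suc M := \<gamma> (Suc M) + 1)"
    obtain c where c: "c > 0" "\<And>m. m \<ge> 1 \<Longrightarrow> c \<le> \<gamma> m"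
      using \<gamma> unfolding positive_rates_def by blast
    have "c \<le> \<gamma>' m" if "m \<ge> 1" for m
      using c(2)[OF that] unfolding \<gamma>'_def by auto
    then have \<gamma>': "positive_rates \<gamma>'"
      using c unfolding positive_rates_def by blast
    have agree: "\<forall>m\<in>{1..M}. \<gamma> m = \<gamma>' m" unfolding \<gamma>'_def by auto
    have "fps_nth (dispersion_series v \<gamma>) (2 * M + 2) \<noteq> fps_nth (dispersion_series v \<gamma>') (2 * M + 2)"
      using agree v by (intro dispersion_series_differ \<gamma> \<gamma>') (auto simp: \<gamma>'_def)
    then show "\<exists>\<gamma>'. positive_rates \<gamma>' \<and> (\<forall>m\<in>{1..M}. \<gamma> m = \<gamma>' m) \<and>
         fps_nth (dispersion_series v \<gamma>) (2 * M + 2) \<noteq>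
         fps_nth (dispersion_series v \<gamma>') (2 * M + 2)"
      using \<gamma>' agree by blast
  qed
qed

end
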